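(* Let $(\widetilde{\boldsymbol{x}},\boldsymbol{\ell}^+,\boldsymbol{\ell}^-):U\to\mathbb{R}^3_1\times\Delta_4$ be a lightcone framed surface, and denote $\widetilde{\boldsymbol{x}}(u,v)=(x_1,x_2,x_3)(u,v)$. Suppose $x_1(u,v)>0$ and $(x_1^2-x_2^2-x_3^2)(u,v)>1$ for all $(u,v)\in U$. Then for each $i\in\{2,3,4\}$, $\boldsymbol{x}=\boldsymbol{p}_i\circ\widetilde{\boldsymbol{x}}:U\to H^3$ is a hyperbolic generalized framed base surface.
   Context: $\mathbb{R}^n_1$ is $\mathbb{R}^n$ with the pseudo inner product $\langle \boldsymbol{x},\boldsymbol{y}\rangle=-x_1y_1+\sum_{j=2}^n x_jy_j$. For $n=4$, the pseudo vector product $\boldsymbol{x}\wedge\boldsymbol{y}\wedge\boldsymbol{z}$ is the unique vector of $\mathbb{R}^4_1$ with $\langle \boldsymbol{w},\boldsymbol{x}\wedge\boldsymbol{y}\wedge\boldsymbol{z}\rangle=\det(\boldsymbol{w},\boldsymbol{x},\boldsymbol{y},\boldsymbol{z})$ for all $\boldsymbol{w}$; for $n=3$, $\boldsymbol{x}\wedge\boldsymbol{y}$ is the unique vector of $\mathbb{R}^3_1$ with $\langle \boldsymbol{w},\boldsymbol{x}\wedge\boldsymbol{y}\rangle=\det(\boldsymbol{w},\boldsymbol{x},\boldsymbol{y})$ for all $\boldsymbol{w}$. $H^3=\{\boldsymbol{x}\in\mathbb{R}^4_1: \langle\boldsymbol{x},\boldsymbol{x}\rangle=-1,\ x_1>0\}$,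 $S^3_1=\{\boldsymbol{x}\in\mathbb{R}^4_1:\langle\boldsymbol{x},\boldsymbol{x}\rangle=1\}$, $\Delta_5=\{(\boldsymbol{\nu}_1,\boldsymbol{\nu}_2)\in S^3_1\times S^3_1:\langle\boldsymbol{\nu}_1,\boldsymbol{\nu}_2\rangle=0\}$. $U$ is a simply connected open subset of $\mathbb{R}^2$ with coordinates $(u,v)$; subscripts $u,v$ on maps denote partial derivatives; all maps are $C^\infty$. Let $LC^*=\{\boldsymbol{x}\in\mathbb{R}^3_1\setminus\{\boldsymbol{0}\}:\langle\boldsymbol{x},\boldsymbol{x}\rangle=0\}$ and $\Delta_4=\{(\boldsymbol{\nu}_1,\boldsymbol{\nu}_2)\in LC^*\times LC^*:\langle\boldsymbol{\nu}_1,\boldsymbol{\nu}_2\rangle=-2\}$. A smooth map $(\widetilde{\boldsymbol{x}},\boldsymbol{\ell}^+,\boldsymbol{\ell}^-):U\to\mathbb{R}^3_1\times\Delta_4$ is a lightcone framed surface if there are smooth functions $\widetilde{\alpha},\widetilde{\beta}:U\to\mathbb{R}$ with $\widetilde{\boldsymbol{x}}_u\wedge\widetilde{\boldsymbol{x}}_v=\widetilde{\alpha}\boldsymbol{\ell}^++\widetilde{\beta}\boldsymbol{\ell}^-$ on $U$. For $(a,b,c)\in\mathbb{R}^3_1$ with $a^2-b^2-c^2>1$ put $r=\sqrt{-1+a^2-b^2-c^2}$ and $\boldsymbol{p}_2(a,b,c)=(a,r,b,c)$, $\boldsymbol{p}_3(a,b,c)=(a,b,r,c)$, $\boldsymbol{p}_4(a,b,c)=(a,b,c,r)$.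 A smooth map $(\boldsymbol{x},\boldsymbol{\nu}_1,\boldsymbol{\nu}_2):U\to H^3\times\Delta_5$ is a hyperbolic generalized framed surface if $\langle\boldsymbol{x},\boldsymbol{\nu}_1\rangle=\langle\boldsymbol{x},\boldsymbol{\nu}_2\rangle=0$ on $U$ and there are smooth functions $\alpha,\beta:U\to\mathbb{R}$ with $\boldsymbol{x}\wedge\boldsymbol{x}_u\wedge\boldsymbol{x}_v=\alpha\boldsymbol{\nu}_1+\beta\boldsymbol{\nu}_2$ on $U$. A smooth map $\boldsymbol{x}:U\to H^3$ is a hyperbolic generalized framed base surface if there is a smooth $(\boldsymbol{\nu}_1,\boldsymbol{\nu}_2):U\to\Delta_5$ such that $(\boldsymbol{x},\boldsymbol{\nu}_1,\boldsymbol{\nu}_2)$ is a hyperbolic generalized framed surface. *)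

theory Defs
  imports "HOL-Analysis.Analysis"
begin

section \<open>Smooth maps\<close>

text \<open>
  \<open>Ck_on k S f\<close>: all iterated directional derivatives of \<open>f\<close> of order less than \<open>k\<close> are
  (Frechet) differentiable on \<open>S\<close>, and those of order \<open>k\<close> are continuous. For open \<open>S\<close> this is
  the usual class \<open>C\<^sup>k\<close>; the values of \<open>f\<close> outside \<open>S\<close> are irrelevant then. The
  definition is meant for open \<open>S\<close> only.
\<close>

primrec Ck_on ::
  "nat \<Rightarrow> 'a::real_normed_vector set \<Rightarrow> ('a \<Rightarrow> 'b::real_normed_vector) \<Rightarrow> bool" where
  "Ck_on 0 S f \<longleftrightarrow> continuous_on S f"
| "Ck_on (Suc k) S f \<longleftrightarrow>
     (\<forall>p\<in>S. f differentiable (at p)) \<and>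
     (\<forall>h. Ck_on k S (\<lambda>p. frechet_derivative f (at p) h))"

definition smooth_on ::
  "'a::real_normed_vector set \<Rightarrow> ('a \<Rightarrow> 'b::real_normed_vector) \<Rightarrow> bool" where
  "smooth_on S f \<longleftrightarrow> (\<forall>k. Ck_on k S f)"

definition partial_u :: "(real \<times> real \<Rightarrow> 'b::real_normed_vector) \<Rightarrow> real \<times> real \<Rightarrow> 'b" where
  "partial_u f p = vector_derivative (\<lambda>s. f (s, snd p)) (at (fst p))"

definition partial_v :: "(real \<times> real \<Rightarrow> 'b::real_normed_vector) \<Rightarrow> real \<times> real \<Rightarrow> 'b" where
  "partial_v f p = vector_derivative (\<lambda>t. f (fst p, t)) (at (snd p))"


section \<open>Lorentz--Minkowski space\<close>

text \<open>The first coordinate, i.e. the index \<open>1\<close> of the numeral type, is the timelike one.\<close>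

definition lorentz_inner :: "real ^ 'n::{finite,one} \<Rightarrow> real ^ 'n::{finite,one} \<Rightarrow> real" where
  "lorentz_inner x y = - (x $ 1 * y $ 1) + (\<Sum>j\<in>UNIV - {1}. x $ j * y $ j)"

lemma lorentz_inner_3:
  "lorentz_inner x (y :: real ^ 3) = - (x$1 * y$1) + x$2 * y$2 + x$3 * y$3"
proof -
  have "UNIV - {1} = {2, 3::3}" using UNIV_3 by auto
  then show ?thesis by (simp add: lorentz_inner_def)
qed

lemma lorentz_inner_4:
  "lorentz_inner x (y :: real ^ 4) = - (x$1 * y$1) + x$2 * y$2 + x$3 * y$3 + x$4 * y$4"
proof -
  have "UNIV - {1} = {2, 3, 4::4}" using UNIV_4 by auto
  then show ?thesis by (simp add: lorentz_inner_def)
qed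

definition lorentz_wedge2 :: "real ^ 3 \<Rightarrow> real ^ 3 \<Rightarrow> real ^ 3" where
  "lorentz_wedge2 x y =
     (THE t. \<forall>w. lorentz_inner w t = det (vector [w, x, y] :: real ^ 3 ^ 3))"

definition lorentz_wedge3 :: "real ^ 4 \<Rightarrow> real ^ 4 \<Rightarrow> real ^ 4 \<Rightarrow> real ^ 4" where
  "lorentz_wedge3 x y z =
     (THE t. \<forall>w. lorentz_inner w t = det (vector [w, x, y, z] :: real ^ 4 ^ 4))"

text \<open>The vectors described above exist and are unique, as the inner product is nondegenerate.\<close>

lemma lorentz_representation:
  fixes \<phi> :: "real ^ 'n::{finite,one} \<Rightarrow> real"
  assumes "linear \<phi>"
  shows "\<exists>!t. \<forall>w. lorentz_inner w t = \<phi> w"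
proof -
  have ax: "lorentz_inner (axis i 1) t = (if i = 1 then - t $ i else t $ i)"
    for i and t :: "real ^ 'n::{finite,one}"
    by (auto simp: lorentz_inner_def axis_def if_distrib[where f = "\<lambda>a. a * _"] sum.delta' cong: if_cong)
  have lin: "linear (\<lambda>w. lorentz_inner w t)" for t :: "real ^ 'n::{finite,one}"
    by (rule linearI)
      (simp_all add: lorentz_inner_def distrib_right right_diff_distrib sum.distrib sum_distrib_left mult.assoc)
  show ?thesis
  proof (rule ex_ex1I)
    define t where "t = (\<chi> i. if i = 1 then - \<phi> (axis i 1) else \<phi> (axis i (1::real)))"
    have "(\<lambda>w. lorentz_inner w t) = \<phi>"
      by (rule linear_eq_stdbasis[OF lin assms]) (auto simp: Basis_vec_def ax t_def)
    then show "\<exists>t. \<forall>w. lorentz_inner w t = \<phi> w" by metis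
  next
    fix s t assume "\<forall>w. lorentz_inner w s = \<phi> w" and "\<forall>w. lorentz_inner w t = \<phi> w"
    then have "lorentz_inner (axis i 1) s = lorentz_inner (axis i 1) t" for i by simp
    then show "s = t" unfolding ax vec_eq_iff by (metis neg_equal_iff_equal)
  qed
qed

lemma linear_det_first_row:
  fixes A :: "'n::{finite,one} \<Rightarrow> real ^ 'n::{finite,one}"
  shows "linear (\<lambda>w. det (\<chi> i. if i = 1 then w else A i))"
proof (rule linearI)
  show "det (\<chi> i. if i = 1 then r *\<^sub>R b else A i) = r *\<^sub>R det (\<chi> i. if i = 1 then b else A i)"
    for r b
  proof -
    have "r *s b = r *\<^sub>R b" by (simp add: vec_eq_iff)
    then show ?thesis using det_row_mul[of 1 r "\<lambda>_. b" A] by (simp cong: if_cong)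
  qed
qed (simp add: det_row_add)

lemma lorentz_wedge2_unique:
  "\<exists>!t. \<forall>w. lorentz_inner w t = det (vector [w, x, y] :: real ^ 3 ^ 3)"
proof -
  have "(vector [w, x, y] :: real ^ 3 ^ 3) = (\<chi> i. if i = 1 then w else vector [0, x, y] $ i)" for w
    by (simp add: vec_eq_iff forall_3)
  with lorentz_representation[OF linear_det_first_row[of "\<lambda>i. vector [0, x, y] $ i"]]
  show ?thesis by simp
qed

lemma vector_4:
  "(vector [a, b, c, d] :: 'a::zero ^ 4) $ 1 = a"
  "(vector [a, b, c, d] :: 'a ^ 4) $ 2 = b"
  "(vector [a, b, c, d] :: 'a ^ 4) $ 3 = c"
  "(vector [a, b, c, d] :: 'a ^ 4) $ 4 = d"
  by (simp_all add: vector_def)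

lemma lorentz_wedge3_unique:
  "\<exists>!t. \<forall>w. lorentz_inner w t = det (vector [w, x, y, z] :: real ^ 4 ^ 4)"
proof -
  have "(vector [w, x, y, z] :: real ^ 4 ^ 4)
      = (\<chi> i. if i = 1 then w else vector [0, x, y, z] $ i)" for w
    by (simp add: vec_eq_iff forall_4 vector_4)
  with lorentz_representation[OF linear_det_first_row[of "\<lambda>i. vector [0, x, y, z] $ i"]]
  show ?thesis by simp
qed

definition hyperbolic_3_space :: "(real ^ 4) set" where
  "hyperbolic_3_space = {x. lorentz_inner x x = -1 \<and> x $ 1 > 0}"

definition de_sitter_3_space :: "(real ^ 4) set" where
  "de_sitter_3_space = {x. lorentz_inner x x = 1}"

definition Delta5 :: "((real ^ 4) \<times> (real ^ 4)) set" where
  "Delta5 = {(\<nu>1, \<nu>2) \<in> de_sitter_3_space \<times> de_sitter_3_space. lorentz_inner \<nu>1 \<nu>2 = 0}"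

definition lightcone :: "(real ^ 3) set" where
  "lightcone = {x. x \<noteq> 0 \<and> lorentz_inner x x = 0}"

definition Delta4 :: "((real ^ 3) \<times> (real ^ 3)) set" where
  "Delta4 = {(\<nu>1, \<nu>2) \<in> lightcone \<times> lightcone. lorentz_inner \<nu>1 \<nu>2 = -2}"


section \<open>Framed surfaces\<close>

definition lightcone_framed_surface ::
  "(real \<times> real) set \<Rightarrow> (real \<times> real \<Rightarrow> real ^ 3) \<Rightarrow> (real \<times> real \<Rightarrow> real ^ 3)
     \<Rightarrow> (real \<times> real \<Rightarrow> real ^ 3) \<Rightarrow> bool" where
  "lightcone_framed_surface U x lp lm \<longleftrightarrow>
     smooth_on U x \<and> smooth_on U lp \<and> smooth_on U lm \<and>
     (\<forall>p\<in>U. (lp p, lm p) \<in> Delta4) \<and>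
     (\<exists>\<alpha> \<beta> :: real \<times> real \<Rightarrow> real. smooth_on U \<alpha> \<and> smooth_on U \<beta> \<and>
        (\<forall>p\<in>U. lorentz_wedge2 (partial_u x p) (partial_v x p)
                 = \<alpha> p *\<^sub>R lp p + \<beta> p *\<^sub>R lm p))"

definition hyperbolic_generalized_framed_surface ::
  "(real \<times> real) set \<Rightarrow> (real \<times> real \<Rightarrow> real ^ 4) \<Rightarrow> (real \<times> real \<Rightarrow> real ^ 4)
     \<Rightarrow> (real \<times> real \<Rightarrow> real ^ 4) \<Rightarrow> bool" where
  "hyperbolic_generalized_framed_surface U x \<nu>1 \<nu>2 \<longleftrightarrow>
     smooth_on U x \<and> smooth_on U \<nu>1 \<and> smooth_on U \<nu>2 \<and>
     (\<forall>p\<in>U. x p \<in> hyperbolic_3_space \<and> (\<nu>1 p, \<nu>2 p) \<in> Delta5) \<and>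
     (\<forall>p\<in>U. lorentz_inner (x p) (\<nu>1 p) = 0 \<and> lorentz_inner (x p) (\<nu>2 p) = 0) \<and>
     (\<exists>\<alpha> \<beta> :: real \<times> real \<Rightarrow> real. smooth_on U \<alpha> \<and> smooth_on U \<beta> \<and>
        (\<forall>p\<in>U. lorentz_wedge3 (x p) (partial_u x p) (partial_v x p)
                 = \<alpha> p *\<^sub>R \<nu>1 p + \<beta> p *\<^sub>R \<nu>2 p))"

definition hyperbolic_generalized_framed_base_surface ::
  "(real \<times> real) set \<Rightarrow> (real \<times> real \<Rightarrow> real ^ 4) \<Rightarrow> bool" where
  "hyperbolic_generalized_framed_base_surface U x \<longleftrightarrow>
     (\<exists>\<nu>1 \<nu>2. hyperbolic_generalized_framed_surface U x \<nu>1 \<nu>2)"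


section \<open>Graph maps into hyperbolic space\<close>

text \<open>
  These are used only on the set of \<open>y\<close> with \<open>(y$1)\<^sup>2 - (y$2)\<^sup>2 - (y$3)\<^sup>2 > 1\<close>;
  elsewhere the values are meaningless.
\<close>

definition graph_height :: "real ^ 3 \<Rightarrow> real" where
  "graph_height y = sqrt (- 1 + (y$1)\<^sup>2 - (y$2)\<^sup>2 - (y$3)\<^sup>2)"

definition p2 :: "real ^ 3 \<Rightarrow> real ^ 4" where
  "p2 y = vector [y$1, graph_height y, y$2, y$3]"

definition p3 :: "real ^ 3 \<Rightarrow> real ^ 4" where
  "p3 y = vector [y$1, y$2, graph_height y, y$3]"

definition p4 :: "real ^ 3 \<Rightarrow> real ^ 4" where
  "p4 y = vector [y$1, y$2, y$3, graph_height y]"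

end

theory Submission
  imports Defs
begin

text \<open>
  Write \<open>y\<close> for the given surface in Minkowski 3-space, \<open>r = sqrt (- 1 - \<langle>y, y\<rangle>)\<close>, and
  \<open>x = E y + r e\<close> for the surface in hyperbolic space, where \<open>E\<close> inserts a zero coordinate and
  \<open>e\<close> is the spacelike unit vector of the inserted coordinate. Differentiating
  \<open>r\<^sup>2 = - 1 - \<langle>y, y\<rangle>\<close> gives \<open>r r\<^sub>u = - \<langle>y, y\<^sub>u\<rangle>\<close>, and likewise for \<open>v\<close>. With these
  relations the triple wedge \<open>x \<and> x\<^sub>u \<and> x\<^sub>v\<close> is, up to a constant sign, the image of
  \<open>y\<^sub>u \<and> y\<^sub>v\<close> under a linear map \<open>L\<close> from Minkowski 3-space to the orthogonal complement of
  \<open>x\<close>; the map \<open>L\<close> depends smoothly on the base point (\<open>wedge3_eq_lift\<close>).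

  Hence \<open>y\<^sub>u \<and> y\<^sub>v = \<alpha> \<ell>\<^sup>+ + \<beta> \<ell>\<^sup>-\<close> turns into
  \<open>x \<and> x\<^sub>u \<and> x\<^sub>v = \<plusminus> (\<alpha> L \<ell>\<^sup>+ + \<beta> L \<ell>\<^sup>-)\<close>, so that the triple wedge lies in the span of two
  smooth fields orthogonal to \<open>x\<close>. This also holds where \<open>y\<^sub>u\<close> and \<open>y\<^sub>v\<close> are linearly dependent,
  because only linearity of \<open>L\<close> enters. If the Gram matrix of \<open>L \<ell>\<^sup>+\<close> and \<open>L \<ell>\<^sup>-\<close> is positive
  definite, Gram--Schmidt yields the smooth orthonormal frame
  (\<open>generalized_framed_base_surfaceI\<close>).

  With \<open>P = \<langle>y, \<ell>\<^sup>+\<rangle>\<close> and \<open>Q = \<langle>y, \<ell>\<^sup>-\<rangle>\<close> that Gram matrix is \<open>1 / r\<^sup>2\<close> times the matrix with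
  diagonal \<open>P\<^sup>2, Q\<^sup>2\<close> and off-diagonal entry \<open>P Q - 2\<close>, whose determinant is \<open>4 (P Q - 1)\<close>.
  Positivity is therefore the inequality \<open>P Q > 1\<close>, which comes from the Gram determinant of
  \<open>y, \<ell>\<^sup>+, \<ell>\<^sup>-\<close> being minus a square (\<open>lightlike_pair_products\<close>).
\<close>

section \<open>Closure properties of smooth maps\<close>

lemma frechet_derivative_at_eq:
  "(f has_derivative f') (at p) \<Longrightarrow> frechet_derivative f (at p) h = f' h"
  using frechet_derivative_at by metis

lemma frechet_derivativeD:
  "f differentiable (at p) \<Longrightarrow> (f has_derivative (\<lambda>h. frechet_derivative f (at p) h)) (at p)"
  by (simp add: frechet_derivative_works)

lemma Ck_on_cong:
  assumes "open S" "Ck_on k S f" "\<And>p. p \<in> S \<Longrightarrow> f p = g p"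
  shows "Ck_on k S g"
  using assms(2,3)
proof (induction k arbitrary: f g)
  case 0
  then show ?case by (simp cong: continuous_on_cong)
next
  case (Suc k)
  have der: "(g has_derivative (\<lambda>h. frechet_derivative f (at p) h)) (at p)" if "p \<in> S" for p
  proof -
    have "f differentiable (at p)" using Suc.prems(1) that by simp
    from frechet_derivativeD[OF this] show ?thesis
      using has_derivative_transform_within_open[OF _ assms(1) that] Suc.prems(2) by blast
  qed
  have "Ck_on k S (\<lambda>p. frechet_derivative g (at p) h)" for h
  proof (rule Suc.IH)
    show "Ck_on k S (\<lambda>p. frechet_derivative f (at p) h)" using Suc.prems(1) by simp
    show "frechet_derivative f (at p) h = frechet_derivative g (at p) h" if "p \<in> S" for p
      by (rule frechet_derivative_at_eq[OF der[OF that], symmetric])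
  qed
  moreover have "g differentiable (at p)" if "p \<in> S" for p
    using der[OF that] unfolding differentiable_def by blast
  ultimately show ?case by simp
qed

text \<open>
  The derivative may be supplied as any explicit formula \<open>f'\<close>; the closure lemmas below use the
  sum, product and chain rules in this form, by induction on the order.
\<close>

lemma Ck_on_SucI:
  assumes "open S"
    and "\<And>p. p \<in> S \<Longrightarrow> (f has_derivative f' p) (at p)"
    and "\<And>h. Ck_on k S (\<lambda>p. f' p h)"
  shows "Ck_on (Suc k) S f"
proof -
  have "f differentiable (at p)" if "p \<in> S" for p
    using assms(2)[OF that] unfolding differentiable_def by blast
  moreover have "Ck_on k S (\<lambda>p. frechet_derivative f (at p) h)" for h
    by (rule Ck_on_cong[OF assms(1,3)]) (rule frechet_derivative_at_eq[OF assms(2), symmetric])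
  ultimately show ?thesis by simp
qed

lemma Ck_on_SucD:
  assumes "Ck_on (Suc k) S f"
  shows "Ck_on k S f"
  using assms
proof (induction k arbitrary: f)
  case 0
  then show ?case
    by (auto intro!: differentiable_imp_continuous_on simp: differentiable_on_def
        differentiable_at_withinI)
next
  case (Suc k)
  note prems = Suc.prems[THEN Ck_on.simps(2)[THEN iffD1]]
  show ?case
    by (rule Ck_on.simps(2)[THEN iffD2])
      (intro conjI allI conjunct1[OF prems] Suc.IH conjunct2[OF prems, rule_format])
qed

lemma Ck_on_const: "Ck_on k S (\<lambda>_. c)"
proof (induction k arbitrary: c)
  case (Suc k)
  have "frechet_derivative (\<lambda>_. c) (at p) = (\<lambda>_. 0)" for p :: 'a
    by (rule frechet_derivative_const)
  with Suc show ?case by simp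
qed simp

lemma Ck_on_add:
  assumes "open S" "Ck_on k S f" "Ck_on k S g"
  shows "Ck_on k S (\<lambda>p. f p + g p)"
  using assms(2,3)
proof (induction k arbitrary: f g)
  case (Suc k)
  show ?case
  proof (rule Ck_on_SucI[OF assms(1)])
    show "((\<lambda>p. f p + g p) has_derivative
        (\<lambda>h. frechet_derivative f (at p) h + frechet_derivative g (at p) h)) (at p)" if "p \<in> S" for p
      using Suc.prems that by (intro has_derivative_add frechet_derivativeD) simp_all
    show "Ck_on k S (\<lambda>p. frechet_derivative f (at p) h + frechet_derivative g (at p) h)" for h
      using Suc.prems by (intro Suc.IH) simp_all
  qed
qed (simp add: continuous_on_add)

lemma Ck_on_bounded_linear:
  assumes "open S" "bounded_linear L" "Ck_on k S f"
  shows "Ck_on k S (\<lambda>p. L (f p))"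
  using assms(3)
proof (induction k arbitrary: f)
  case 0
  then show ?case by (simp add: bounded_linear.continuous_on[OF assms(2)])
next
  case (Suc k)
  show ?case
  proof (rule Ck_on_SucI[OF assms(1)])
    show "((\<lambda>p. L (f p)) has_derivative (\<lambda>h. L (frechet_derivative f (at p) h))) (at p)"
      if "p \<in> S" for p
      using Suc.prems that
      by (intro bounded_linear.has_derivative[OF assms(2)] frechet_derivativeD) simp_all
    show "Ck_on k S (\<lambda>p. L (frechet_derivative f (at p) h))" for h
      using Suc.prems by (intro Suc.IH) simp_all
  qed
qed

lemma Ck_on_bounded_bilinear:
  assumes "open S" "bounded_bilinear B" "Ck_on k S f" "Ck_on k S g"
  shows "Ck_on k S (\<lambda>p. B (f p) (g p))"
  using assms(3,4)
proof (induction k arbitrary: f g)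
  case 0
  then show ?case
    unfolding Ck_on.simps(1) by (rule bounded_bilinear.continuous_on[OF assms(2)])
next
  case (Suc k)
  show ?case
  proof (rule Ck_on_SucI[OF assms(1)])
    show "((\<lambda>p. B (f p) (g p)) has_derivative
        (\<lambda>h. B (f p) (frechet_derivative g (at p) h) + B (frechet_derivative f (at p) h) (g p))) (at p)"
      if "p \<in> S" for p
      using Suc.prems that
      by (intro bounded_bilinear.FDERIV[OF assms(2)] frechet_derivativeD) simp_all
    show "Ck_on k S (\<lambda>p. B (f p) (frechet_derivative g (at p) h)
                      + B (frechet_derivative f (at p) h) (g p))" for h
      using Suc.prems Suc.prems[THEN Ck_on_SucD]
      by (intro Ck_on_add[OF assms(1)] Suc.IH) simp_all
  qed
qed

text \<open>
  The derivative of \<open>1 / f\<close> is a product of \<open>f'\<close> with two factors \<open>1 / f\<close>, which are one order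
  less demanding, so that the induction closes without a general chain rule. The square root works
  in the same way, its derivative being \<open>f' / (2 sqrt f)\<close>.
\<close>

lemma Ck_on_inverse:
  fixes f :: "'a::real_normed_vector \<Rightarrow> real"
  assumes "open S" "Ck_on k S f" "\<And>p. p \<in> S \<Longrightarrow> f p \<noteq> 0"
  shows "Ck_on k S (\<lambda>p. inverse (f p))"
  using assms(2,3)
proof (induction k arbitrary: f)
  case (Suc k)
  note mult = Ck_on_bounded_bilinear[OF assms(1) bounded_bilinear_mult]
  note neg = Ck_on_bounded_linear[OF assms(1) bounded_linear_minus[OF bounded_linear_ident]]
  have inv: "Ck_on k S (\<lambda>p. inverse (f p))"
    using Suc.prems by (intro Suc.IH Ck_on_SucD[OF Suc.prems(1)]) simp_all
  show ?case
  proof (rule Ck_on_SucI[OF assms(1)])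
    show "((\<lambda>p. inverse (f p)) has_derivative
        (\<lambda>h. - (inverse (f p) * frechet_derivative f (at p) h * inverse (f p)))) (at p)"
      if "p \<in> S" for p
      using Suc.prems that by (intro Deriv.has_derivative_inverse frechet_derivativeD) simp_all
    show "Ck_on k S (\<lambda>p. - (inverse (f p) * frechet_derivative f (at p) h * inverse (f p)))" for h
      using Suc.prems by (intro neg mult inv) simp_all
  qed
qed (simp add: continuous_on_inverse)

lemma Ck_on_sqrt:
  fixes f :: "'a::real_normed_vector \<Rightarrow> real"
  assumes "open S" "Ck_on k S f" "\<And>p. p \<in> S \<Longrightarrow> f p > 0"
  shows "Ck_on k S (\<lambda>p. sqrt (f p))"
  using assms(2,3)
proof (induction k arbitrary: f)
  case 0
  then show ?case by (simp add: continuous_on_real_sqrt)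
next
  case (Suc k)
  note mult = Ck_on_bounded_bilinear[OF assms(1) bounded_bilinear_mult]
  have root: "Ck_on k S (\<lambda>p. sqrt (f p))"
    using Suc.prems by (intro Suc.IH Ck_on_SucD[OF Suc.prems(1)]) simp_all
  have der: "((\<lambda>p. sqrt (f p)) has_derivative
      (\<lambda>h. frechet_derivative f (at p) h * (inverse (sqrt (f p)) * (1/2)))) (at p)"
    if "p \<in> S" for p
  proof -
    have "f p > 0" "f differentiable (at p)" using Suc.prems that by auto
    from has_derivative_real_sqrt[OF this(1) frechet_derivativeD[OF this(2)]]
    show ?thesis by (simp add: field_simps)
  qed
  show ?case
  proof (rule Ck_on_SucI[OF assms(1) der])
    have "sqrt (f p) \<noteq> 0" if "p \<in> S" for p
      using Suc.prems(2)[OF that] by simp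
    then show "Ck_on k S (\<lambda>p. frechet_derivative f (at p) h * (inverse (sqrt (f p)) * (1/2)))" for h
      using Suc.prems(1) by (intro mult Ck_on_inverse[OF assms(1) root] Ck_on_const) simp_all
  qed
qed

context
  fixes S :: "'a::real_normed_vector set"
  assumes S: "open S"
begin

lemma smooth_on_const: "smooth_on S (\<lambda>_. c)"
  by (simp add: smooth_on_def Ck_on_const)

lemma smooth_on_add:
  "smooth_on S f \<Longrightarrow> smooth_on S g \<Longrightarrow> smooth_on S (\<lambda>p. f p + g p)"
  by (simp add: smooth_on_def Ck_on_add[OF S])

lemma smooth_on_bounded_linear:
  "bounded_linear L \<Longrightarrow> smooth_on S f \<Longrightarrow> smooth_on S (\<lambda>p. L (f p))"
  by (simp add: smooth_on_def Ck_on_bounded_linear[OF S])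

lemma smooth_on_bounded_bilinear:
  "bounded_bilinear B \<Longrightarrow> smooth_on S f \<Longrightarrow> smooth_on S g \<Longrightarrow> smooth_on S (\<lambda>p. B (f p) (g p))"
  by (simp add: smooth_on_def Ck_on_bounded_bilinear[OF S])

lemmas smooth_on_scaleR = smooth_on_bounded_bilinear[OF bounded_bilinear_scaleR]
lemmas smooth_on_mult = smooth_on_bounded_bilinear[OF bounded_bilinear_mult]

lemma smooth_on_diff:
  "smooth_on S f \<Longrightarrow> smooth_on S g \<Longrightarrow> smooth_on S (\<lambda>p. f p - g p)"
  using smooth_on_add[OF _ smooth_on_bounded_linear[OF bounded_linear_minus[OF bounded_linear_ident]]]
  by fastforce

lemma smooth_on_inverse:
  fixes f :: "'a \<Rightarrow> real"
  shows "smooth_on S f \<Longrightarrow> (\<And>p. p \<in> S \<Longrightarrow> f p \<noteq> 0) \<Longrightarrow> smooth_on S (\<lambda>p. inverse (f p))"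
  by (simp add: smooth_on_def Ck_on_inverse[OF S])

lemma smooth_on_sqrt:
  fixes f :: "'a \<Rightarrow> real"
  shows "smooth_on S f \<Longrightarrow> (\<And>p. p \<in> S \<Longrightarrow> f p > 0) \<Longrightarrow> smooth_on S (\<lambda>p. sqrt (f p))"
  by (simp add: smooth_on_def Ck_on_sqrt[OF S])

end

lemma smooth_on_differentiable:
  "smooth_on S f \<Longrightarrow> p \<in> S \<Longrightarrow> f differentiable (at p)"
  unfolding smooth_on_def by (metis Ck_on.simps(2))

lemma partial_u_eq:
  assumes "(f has_derivative f') (at p)"
  shows "partial_u f p = f' (1, 0)"
proof -
  have "((\<lambda>s. (s, snd p)) has_vector_derivative (1, 0)) (at (fst p))"
    by (auto intro!: derivative_eq_intros)
  then have "((\<lambda>s. f (s, snd p)) has_vector_derivative f' (1, 0)) (at (fst p))"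
    using vector_derivative_diff_chain_within[of "\<lambda>s. (s, snd p)" "(1,0)" "fst p" UNIV f f']
      has_derivative_at_withinI[OF assms] by (simp add: o_def)
  then show ?thesis by (simp add: partial_u_def vector_derivative_at)
qed

lemma partial_v_eq:
  assumes "(f has_derivative f') (at p)"
  shows "partial_v f p = f' (0, 1)"
proof -
  have "((\<lambda>t. (fst p, t)) has_vector_derivative (0, 1)) (at (snd p))"
    by (auto intro!: derivative_eq_intros)
  then have "((\<lambda>t. f (fst p, t)) has_vector_derivative f' (0, 1)) (at (snd p))"
    using vector_derivative_diff_chain_within[of "\<lambda>t. (fst p, t)" "(0,1)" "snd p" UNIV f f']
      has_derivative_at_withinI[OF assms] by (simp add: o_def)
  then show ?thesis by (simp add: partial_v_def vector_derivative_at)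
qed


section \<open>Algebra of the Lorentz product\<close>

lemma bounded_bilinear_lorentz_inner: "bounded_bilinear (lorentz_inner :: real^'n::{finite,one} \<Rightarrow> _)"
proof -
  have "bilinear (lorentz_inner :: real^'n::{finite,one} \<Rightarrow> _)"
    by (auto simp: bilinear_def lorentz_inner_def distrib_right distrib_left sum.distrib
        sum_distrib_left mult.assoc mult.left_commute right_diff_distrib intro!: linearI)
  then show ?thesis by (simp add: bilinear_conv_bounded_bilinear)
qed

lemmas lorentz_inner_simps =
  bounded_bilinear.add_left[OF bounded_bilinear_lorentz_inner]
  bounded_bilinear.add_right[OF bounded_bilinear_lorentz_inner]
  bounded_bilinear.diff_left[OF bounded_bilinear_lorentz_inner]
  bounded_bilinear.diff_right[OF bounded_bilinear_lorentz_inner]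
  bounded_bilinear.scaleR_left[OF bounded_bilinear_lorentz_inner]
  bounded_bilinear.scaleR_right[OF bounded_bilinear_lorentz_inner]

lemma lorentz_inner_commute: "lorentz_inner x y = lorentz_inner y x"
  by (simp add: lorentz_inner_def mult.commute)

lemma lorentz_inner_wedge2: "lorentz_inner w (lorentz_wedge2 x y) = det (vector [w, x, y])"
  using theI'[OF lorentz_wedge2_unique[of x y]] by (simp add: lorentz_wedge2_def)

lemma lorentz_wedge3_eqI:
  "(\<And>w. lorentz_inner w t = det (vector [w, x, y, z])) \<Longrightarrow> lorentz_wedge3 x y z = t"
  unfolding lorentz_wedge3_def by (rule the1_equality[OF lorentz_wedge3_unique]) blast

lemma det_4:
  "det (A :: 'a::comm_ring_1^4^4) =
    A$1$1 * (A$2$2 * (A$3$3 * A$4$4 - A$3$4 * A$4$3) - A$2$3 * (A$3$2 * A$4$4 - A$3$4 * A$4$2)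
           + A$2$4 * (A$3$2 * A$4$3 - A$3$3 * A$4$2))
  - A$1$2 * (A$2$1 * (A$3$3 * A$4$4 - A$3$4 * A$4$3) - A$2$3 * (A$3$1 * A$4$4 - A$3$4 * A$4$1)
           + A$2$4 * (A$3$1 * A$4$3 - A$3$3 * A$4$1))
  + A$1$3 * (A$2$1 * (A$3$2 * A$4$4 - A$3$4 * A$4$2) - A$2$2 * (A$3$1 * A$4$4 - A$3$4 * A$4$1)
           + A$2$4 * (A$3$1 * A$4$2 - A$3$2 * A$4$1))
  - A$1$4 * (A$2$1 * (A$3$2 * A$4$3 - A$3$3 * A$4$2) - A$2$2 * (A$3$1 * A$4$3 - A$3$3 * A$4$1)
           + A$2$3 * (A$3$1 * A$4$2 - A$3$2 * A$4$1))"
proof -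
  have f: "finite {2::4, 3, 4}" "1 \<notin> {2::4, 3, 4}"
    "finite {3::4, 4}" "2 \<notin> {3::4, 4}" "finite {4::4}" "3 \<notin> {4::4}" by auto
  show ?thesis
    unfolding det_def UNIV_4
    unfolding sum_over_permutations_insert[OF f(1,2)]
    unfolding sum_over_permutations_insert[OF f(3,4)]
    unfolding sum_over_permutations_insert[OF f(5,6)]
    unfolding permutes_sing
    by (simp add: sign_swap_id permutation_swap_id sign_compose sign_id swap_id_eq
        permutation_compose prod.insert algebra_simps)
qed

text \<open>
  The left-hand side is the Gram determinant of \<open>y, n, m\<close>, expanded along its first row. The Gram
  matrix is \<open>M J M\<^sup>T\<close> with \<open>M\<close> having rows \<open>y, n, m\<close> and \<open>J = diag(-1, 1, 1)\<close>, hence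
  the sign.
\<close>

lemma lorentz_gram_det:
  fixes y n m :: "real^3"
  shows "lorentz_inner y y * (lorentz_inner n n * lorentz_inner m m - (lorentz_inner n m)\<^sup>2)
    - lorentz_inner y n * (lorentz_inner y n * lorentz_inner m m - lorentz_inner n m * lorentz_inner y m)
    + lorentz_inner y m * (lorentz_inner y n * lorentz_inner n m - lorentz_inner n n * lorentz_inner y m)
    = - (det (vector [y, n, m]))\<^sup>2"
  unfolding lorentz_inner_3 det_3 vector_3 by algebra

text \<open>
  For such \<open>n, m\<close> the Gram determinant above reduces to
  \<open>- 4 \<langle>y, y\<rangle> - 4 \<langle>y, n\<rangle> \<langle>y, m\<rangle>\<close>, and it is at most zero.
\<close>

lemma lightlike_pair_products:
  fixes y n m :: "real^3"
  assumes "lorentz_inner y y < -1" "lorentz_inner n n = 0" "lorentz_inner m m = 0"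
    and "lorentz_inner n m = -2"
  shows "lorentz_inner y n * lorentz_inner y m > 1"
proof -
  have "4 * (lorentz_inner y n * lorentz_inner y m)
      = (det (vector [y, n, m]))\<^sup>2 - 4 * lorentz_inner y y"
    using lorentz_gram_det[of y n m] assms(2-4) by (simp add: algebra_simps)
  then show ?thesis
    using assms(1) zero_le_power2[of "det (vector [y, n, m])"] by linarith
qed

text \<open>
  Cramer's rule: in a 3-dimensional space
  \<open>det(y, a, b) z = det(z, a, b) y - det(z, y, b) a + det(z, y, a) b\<close>, paired here with \<open>y\<close>.
\<close>

lemma cramer_identity:
  fixes y z a b :: "real^3"
  shows "lorentz_inner y y * det (vector [z, a, b]) - lorentz_inner y a * det (vector [z, y, b])
      + lorentz_inner y b * det (vector [z, y, a])
    = lorentz_inner z y * det (vector [y, a, b])"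
  unfolding lorentz_inner_3 det_3 vector_3 by algebra


section \<open>Orthonormalising a spanning pair\<close>

text \<open>
  A positive definite Gram matrix lets Gram--Schmidt run with smooth square roots, and the
  coefficients of \<open>a\<close> and \<open>b\<close> in the resulting orthonormal frame are smooth too. This replaces
  the search for an orthonormal frame by the search for a spanning pair.
\<close>

lemma generalized_framed_base_surfaceI:
  fixes x a b :: "real \<times> real \<Rightarrow> real^4"
  assumes U: "open U"
    and smooth: "smooth_on U x" "smooth_on U a" "smooth_on U b" "smooth_on U \<alpha>" "smooth_on U \<beta>"
    and x: "\<And>p. p \<in> U \<Longrightarrow> x p \<in> hyperbolic_3_space"
    and orth: "\<And>p. p \<in> U \<Longrightarrow> lorentz_inner (x p) (a p) = 0"
      "\<And>p. p \<in> U \<Longrightarrow> lorentz_inner (x p) (b p) = 0"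
    and pos: "\<And>p. p \<in> U \<Longrightarrow> lorentz_inner (a p) (a p) > 0"
      "\<And>p. p \<in> U \<Longrightarrow> lorentz_inner (a p) (a p) * lorentz_inner (b p) (b p)
                        > (lorentz_inner (a p) (b p))\<^sup>2"
    and wedge: "\<And>p. p \<in> U \<Longrightarrow> lorentz_wedge3 (x p) (partial_u x p) (partial_v x p)
                  = \<alpha> p *\<^sub>R a p + \<beta> p *\<^sub>R b p"
  shows "hyperbolic_generalized_framed_base_surface U x"
proof -
  define A where "A = (\<lambda>p. lorentz_inner (a p) (a p))"
  define B where "B = (\<lambda>p. lorentz_inner (a p) (b p))"
  define C where "C = (\<lambda>p. lorentz_inner (b p) (b p))"
  \<comment> \<open>\<open>s\<close> is the length of \<open>a\<close>, and \<open>s t\<close> the length of \<open>A b - B a\<close>, which is orthogonal to \<open>a\<close>.\<close>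
  define s where "s = (\<lambda>p. sqrt (A p))"
  define t where "t = (\<lambda>p. sqrt (A p * C p - B p * B p))"
  define \<nu>1 where "\<nu>1 = (\<lambda>p. inverse (s p) *\<^sub>R a p)"
  define \<nu>2 where "\<nu>2 = (\<lambda>p. inverse (s p * t p) *\<^sub>R (A p *\<^sub>R b p - B p *\<^sub>R a p))"
  have Apos: "A p > 0" and Dpos: "A p * C p - B p * B p > 0" if "p \<in> U" for p
    using pos[OF that] by (auto simp: A_def B_def C_def power2_eq_square)
  have s: "s p > 0" "s p * s p = A p" and t: "t p > 0" "t p * t p = A p * C p - B p * B p"
    if "p \<in> U" for p
    using Apos[OF that] Dpos[OF that] by (auto simp: s_def t_def)
  note intros = smooth_on_scaleR[OF U] smooth_on_mult[OF U] smooth_on_diff[OF U]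
    smooth_on_add[OF U] smooth_on_bounded_bilinear[OF U bounded_bilinear_lorentz_inner]
    smooth_on_inverse[OF U] smooth_on_sqrt[OF U] smooth
  have sA: "smooth_on U A" and sB: "smooth_on U B" and sC: "smooth_on U C"
    unfolding A_def B_def C_def by (intro intros)+
  have ss: "smooth_on U s" unfolding s_def by (intro intros sA Apos)
  have st: "smooth_on U t" unfolding t_def by (intro intros sA sB sC Dpos)
  have s\<nu>1: "smooth_on U \<nu>1"
    unfolding \<nu>1_def using s(1) by (intro intros ss) fastforce
  have s\<nu>2: "smooth_on U \<nu>2"
    unfolding \<nu>2_def using s(1) t(1) by (intro intros ss st sA sB) fastforce
  have "(\<nu>1 p, \<nu>2 p) \<in> Delta5" if "p \<in> U" for p
  proof -
    have ba: "lorentz_inner (b p) (a p) = B p" by (simp add: B_def lorentz_inner_commute)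
    have "lorentz_inner (\<nu>1 p) (\<nu>1 p) = A p / (s p * s p)"
      by (simp add: \<nu>1_def lorentz_inner_simps A_def field_simps)
    moreover have "lorentz_inner (\<nu>2 p) (\<nu>2 p)
        = A p * (A p * C p - B p * B p) / ((s p * s p) * (t p * t p))"
      by (simp add: \<nu>2_def lorentz_inner_simps flip: A_def B_def C_def)
        (simp add: ba fun_cong[OF A_def, symmetric] fun_cong[OF B_def, symmetric]
          fun_cong[OF C_def, symmetric] divide_inverse algebra_simps)
    moreover have "lorentz_inner (\<nu>1 p) (\<nu>2 p) = 0"
      by (simp add: \<nu>1_def \<nu>2_def lorentz_inner_simps)
        (simp add: fun_cong[OF A_def] fun_cong[OF B_def])
    ultimately show ?thesis
      using Apos[OF that] Dpos[OF that] unfolding s(2)[OF that] t(2)[OF that]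
      by (simp add: Delta5_def de_sitter_3_space_def)
  qed
  moreover have "lorentz_inner (x p) (\<nu>1 p) = 0" "lorentz_inner (x p) (\<nu>2 p) = 0"
    if "p \<in> U" for p
    using orth[OF that] by (simp_all add: \<nu>1_def \<nu>2_def lorentz_inner_simps)
  moreover have "\<exists>\<alpha>' \<beta>'. smooth_on U \<alpha>' \<and> smooth_on U \<beta>' \<and>
     (\<forall>p\<in>U. lorentz_wedge3 (x p) (partial_u x p) (partial_v x p)
                 = \<alpha>' p *\<^sub>R \<nu>1 p + \<beta>' p *\<^sub>R \<nu>2 p)"
  proof (intro exI conjI ballI)
    show "smooth_on U (\<lambda>p. \<alpha> p * s p + \<beta> p * (B p * inverse (s p)))"
      using s(1) by (intro intros ss sB) fastforce
    show "smooth_on U (\<lambda>p. \<beta> p * (t p * inverse (s p)))"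
      using s(1) by (intro intros ss st) fastforce
    fix p assume p: "p \<in> U"
    have ne: "s p \<noteq> 0" "t p \<noteq> 0" using s(1) t(1) p by fastforce+
    have a: "a p = s p *\<^sub>R \<nu>1 p" using ne by (simp add: \<nu>1_def)
    have b: "b p = (B p * inverse (s p)) *\<^sub>R \<nu>1 p + (t p * inverse (s p)) *\<^sub>R \<nu>2 p"
      using ne by (simp add: \<nu>1_def \<nu>2_def scaleR_right_diff_distrib field_simps flip: s(2)[OF p])
    show "lorentz_wedge3 (x p) (partial_u x p) (partial_v x p)
        = (\<alpha> p * s p + \<beta> p * (B p * inverse (s p))) *\<^sub>R \<nu>1 p
          + (\<beta> p * (t p * inverse (s p))) *\<^sub>R \<nu>2 p"
      unfolding wedge[OF p] by (subst a, subst b) (simp add: algebra_simps)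
  qed
  ultimately show ?thesis
    using smooth(1) s\<nu>1 s\<nu>2 x
    unfolding hyperbolic_generalized_framed_base_surface_def hyperbolic_generalized_framed_surface_def
    by blast
qed


section \<open>Graphs over Minkowski 3-space\<close>

text \<open>
  An orthogonal splitting of Minkowski 4-space into a copy of Minkowski 3-space and a spacelike
  line spanned by the unit vector \<open>e\<close>, compatible with the time orientation. The determinant
  condition is the Laplace expansion along the \<open>e\<close>-coordinate; its sign \<open>\<sigma>\<close> depends on the
  position of that coordinate. Stated in this way, the three graph maps are instances of one
  argument.
\<close>

locale minkowski_splitting =
  fixes E :: "real^3 \<Rightarrow> real^4" and e :: "real^4" and \<sigma> :: real
  assumes E: "linear E"
    and timelike: "(E y + t *\<^sub>R e) $ 1 = y $ 1"
    and inner: "lorentz_inner (E y + t *\<^sub>R e) (E z + s *\<^sub>R e) = lorentz_inner y z + t * s"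
    and span: "\<exists>y t. w = E y + t *\<^sub>R e"
    and det: "det (vector [E z + t *\<^sub>R e, E y + r *\<^sub>R e, E a + ra *\<^sub>R e, E b + rb *\<^sub>R e]) =
        \<sigma> * (t * det (vector [y, a, b]) - r * det (vector [z, a, b])
             + ra * det (vector [z, y, b]) - rb * det (vector [z, y, a]))"
begin

text \<open>
  A vector \<open>E w + c e\<close> is orthogonal to \<open>E a + s e\<close> with \<open>r s = - \<langle>y, a\<rangle>\<close> exactly if
  \<open>r w - c y\<close> is orthogonal to \<open>a\<close>. For two independent directions \<open>a\<close> with common normal \<open>n\<close>
  this makes \<open>r w - c y\<close> a multiple of \<open>n\<close>; the choice \<open>r w - c y = n\<close>, together with
  orthogonality to \<open>E y + r e\<close>, forces \<open>c = \<langle>y, n\<rangle>\<close> when \<open>r\<^sup>2 = - 1 - \<langle>y, y\<rangle>\<close>. This solution is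
  linear in \<open>n\<close>.
\<close>

definition lift :: "real \<Rightarrow> real^3 \<Rightarrow> real^3 \<Rightarrow> real^4" where
  "lift r y n = E (inverse r *\<^sub>R (n + lorentz_inner y n *\<^sub>R y)) + lorentz_inner y n *\<^sub>R e"

lemma lift_linear: "lift r y (c *\<^sub>R n + d *\<^sub>R m) = c *\<^sub>R lift r y n + d *\<^sub>R lift r y m"
  unfolding lift_def
  by (simp add: linear_add[OF E] linear_cmul[OF E] lorentz_inner_simps algebra_simps)

lemma lift_orthogonal:
  assumes "r \<noteq> 0" "r\<^sup>2 = - 1 - lorentz_inner y y"
  shows "lorentz_inner (E y + r *\<^sub>R e) (lift r y n) = 0"
proof -
  have "r * lorentz_inner (E y + r *\<^sub>R e) (lift r y n)
      = lorentz_inner y n * (1 + lorentz_inner y y + r\<^sup>2)"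
    unfolding lift_def inner
    using assms(1) by (simp add: lorentz_inner_simps field_simps power2_eq_square)
  with assms show ?thesis by simp
qed

lemma lift_inner:
  assumes "r \<noteq> 0" "r\<^sup>2 = - 1 - lorentz_inner y y"
  shows "lorentz_inner (lift r y n) (lift r y m)
    = (lorentz_inner n m + lorentz_inner y n * lorentz_inner y m) / r\<^sup>2"
proof -
  have "r\<^sup>2 * lorentz_inner (lift r y n) (lift r y m)
      = lorentz_inner n m + lorentz_inner y n * lorentz_inner y m * (2 + lorentz_inner y y + r\<^sup>2)"
    unfolding lift_def inner using assms(1)
    by (simp add: lorentz_inner_simps lorentz_inner_commute[of n y]
        field_simps power2_eq_square)
  also have "2 + lorentz_inner y y + r\<^sup>2 = 1" using assms(2) by simp
  finally show ?thesis using assms(1) by (simp add: field_simps)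
qed

text \<open>
  Expanding the \<open>4 \<times> 4\<close> determinant along the \<open>e\<close>-coordinate and multiplying by \<open>r\<close>, all
  occurrences of \<open>r\<^sup>2\<close>, \<open>r ra\<close> and \<open>r rb\<close> become Lorentz products with \<open>y\<close>, and Cramer's
  rule collapses the sum of \<open>3 \<times> 3\<close> determinants.
\<close>

lemma wedge3_eq_lift:
  assumes r: "r \<noteq> 0" "r\<^sup>2 = - 1 - lorentz_inner y y"
    and ra: "r * ra = - lorentz_inner y a" and rb: "r * rb = - lorentz_inner y b"
  shows "lorentz_wedge3 (E y + r *\<^sub>R e) (E a + ra *\<^sub>R e) (E b + rb *\<^sub>R e)
    = \<sigma> *\<^sub>R lift r y (lorentz_wedge2 a b)"
proof (rule lorentz_wedge3_eqI)
  fix w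
  obtain z t where w: "w = E z + t *\<^sub>R e" using span by blast
  have "r * (t * det (vector [y, a, b]) - r * det (vector [z, a, b])
             + ra * det (vector [z, y, b]) - rb * det (vector [z, y, a]))
      = r * t * det (vector [y, a, b]) - r\<^sup>2 * det (vector [z, a, b])
        + (r * ra) * det (vector [z, y, b]) - (r * rb) * det (vector [z, y, a])"
    by (simp add: algebra_simps power2_eq_square)
  also have "\<dots> = det (vector [z, a, b]) + lorentz_inner z y * det (vector [y, a, b])
      + r * t * det (vector [y, a, b])"
    unfolding r(2) ra rb using cramer_identity[of y z a b] by (simp add: algebra_simps)
  also have "\<dots> = r * lorentz_inner w (lift r y (lorentz_wedge2 a b))"
    unfolding w lift_def inner using r(1)
    by (simp add: lorentz_inner_simps lorentz_inner_wedge2 field_simps)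
  finally have "t * det (vector [y, a, b]) - r * det (vector [z, a, b])
      + ra * det (vector [z, y, b]) - rb * det (vector [z, y, a])
      = lorentz_inner w (lift r y (lorentz_wedge2 a b))"
    using r(1) by simp
  then show "lorentz_inner w (\<sigma> *\<^sub>R lift r y (lorentz_wedge2 a b))
      = det (vector [w, E y + r *\<^sub>R e, E a + ra *\<^sub>R e, E b + rb *\<^sub>R e])"
    unfolding w det bounded_bilinear.scaleR_right[OF bounded_bilinear_lorentz_inner] by simp
qed

text \<open>
  The fields \<open>lift r y lp\<close> and \<open>lift r y lm\<close> are the spanning pair to be orthonormalised.
\<close>

lemma graph_is_base_surface:
  fixes U :: "(real \<times> real) set" and y lp lm :: "real \<times> real \<Rightarrow> real^3"
  assumes U: "open U"
    and framed: "lightcone_framed_surface U y lp lm"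
    and y1: "\<And>p. p \<in> U \<Longrightarrow> y p $ 1 > 0"
    and yy: "\<And>p. p \<in> U \<Longrightarrow> lorentz_inner (y p) (y p) < -1"
  shows "hyperbolic_generalized_framed_base_surface U
           (\<lambda>p. E (y p) + sqrt (- 1 - lorentz_inner (y p) (y p)) *\<^sub>R e)"
proof -
  define r where "r = (\<lambda>p. sqrt (- 1 - lorentz_inner (y p) (y p)))"
  have r: "r p \<noteq> 0" "(r p)\<^sup>2 = - 1 - lorentz_inner (y p) (y p)" if "p \<in> U" for p
    using yy[OF that] by (auto simp: r_def)
  from framed obtain \<alpha> \<beta> where sm: "smooth_on U y" "smooth_on U lp" "smooth_on U lm"
      "smooth_on U \<alpha>" "smooth_on U \<beta>"
    and D4: "\<And>p. p \<in> U \<Longrightarrow> (lp p, lm p) \<in> Delta4"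
    and wedge: "\<And>p. p \<in> U \<Longrightarrow> lorentz_wedge2 (partial_u y p) (partial_v y p)
                 = \<alpha> p *\<^sub>R lp p + \<beta> p *\<^sub>R lm p"
    unfolding lightcone_framed_surface_def by blast
  have light: "lorentz_inner (lp p) (lp p) = 0" "lorentz_inner (lm p) (lm p) = 0"
    "lorentz_inner (lp p) (lm p) = -2" if "p \<in> U" for p
    using D4[OF that] by (auto simp: Delta4_def lightcone_def)
  have Ebl: "bounded_linear E" using E by (simp add: linear_conv_bounded_linear)
  note intros = smooth_on_scaleR[OF U] smooth_on_mult[OF U] smooth_on_diff[OF U]
    smooth_on_add[OF U] smooth_on_bounded_bilinear[OF U bounded_bilinear_lorentz_inner]
    smooth_on_bounded_linear[OF U Ebl] smooth_on_const[OF U]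
    smooth_on_inverse[OF U] smooth_on_sqrt[OF U] sm
  have sr: "smooth_on U r"
    unfolding r_def by (intro intros) (use yy in fastforce)
  have slift: "smooth_on U (\<lambda>p. lift (r p) (y p) (n p))" if "smooth_on U n" for n
    unfolding lift_def using r(1) by (intro intros sr that)
  have partials:
    "lorentz_wedge3 (E (y p) + r p *\<^sub>R e) (partial_u (\<lambda>p. E (y p) + r p *\<^sub>R e) p)
         (partial_v (\<lambda>p. E (y p) + r p *\<^sub>R e) p)
       = \<sigma> *\<^sub>R lift (r p) (y p) (lorentz_wedge2 (partial_u y p) (partial_v y p))"
    if p: "p \<in> U" for p
  proof -
    define y' where "y' = frechet_derivative y (at p)"
    define r' where "r' = frechet_derivative r (at p)"
    have dy: "(y has_derivative y') (at p)" and dr: "(r has_derivative r') (at p)"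
      unfolding y'_def r'_def
      using smooth_on_differentiable[OF sm(1) p] smooth_on_differentiable[OF sr p]
      by (simp_all add: frechet_derivative_works)
    have dx: "((\<lambda>p. E (y p) + r p *\<^sub>R e) has_derivative (\<lambda>h. E (y' h) + r' h *\<^sub>R e)) (at p)"
      by (intro has_derivative_add bounded_linear.has_derivative[OF Ebl dy]
          bounded_linear.has_derivative[OF bounded_linear_scaleR_left dr])
    \<comment> \<open>Two derivatives of \<open>r\<^sup>2\<close> are compared: one by the product rule, one from
      \<open>r\<^sup>2 = - 1 - \<langle>y, y\<rangle>\<close>.\<close>
    have "((\<lambda>p. r p * r p) has_derivative (\<lambda>h. r p * r' h + r' h * r p)) (at p)"
      by (rule has_derivative_mult[OF dr dr])
    moreover have "((\<lambda>p. r p * r p) has_derivative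
        (\<lambda>h. 0 - (lorentz_inner (y p) (y' h) + lorentz_inner (y' h) (y p)))) (at p)"
    proof (rule has_derivative_transform_within_open[OF _ U p])
      show "((\<lambda>p. - 1 - lorentz_inner (y p) (y p)) has_derivative
          (\<lambda>h. 0 - (lorentz_inner (y p) (y' h) + lorentz_inner (y' h) (y p)))) (at p)"
        by (intro has_derivative_diff has_derivative_const
            bounded_bilinear.FDERIV[OF bounded_bilinear_lorentz_inner dy dy])
      show "- 1 - lorentz_inner (y q) (y q) = r q * r q" if "q \<in> U" for q
        using r(2)[OF that] by (simp add: power2_eq_square)
    qed
    ultimately have eq: "(\<lambda>h. r p * r' h + r' h * r p)
        = (\<lambda>h. 0 - (lorentz_inner (y p) (y' h) + lorentz_inner (y' h) (y p)))"
      by (rule has_derivative_unique)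
    have rr': "r p * r' h = - lorentz_inner (y p) (y' h)" for h
      using fun_cong[OF eq, of h] lorentz_inner_commute[of "y' h" "y p"]
      by (simp add: mult.commute)
    show ?thesis
      unfolding partial_u_eq[OF dx] partial_v_eq[OF dx] partial_u_eq[OF dy] partial_v_eq[OF dy]
      by (rule wedge3_eq_lift[OF r[OF p] rr' rr'])
  qed
  have "hyperbolic_generalized_framed_base_surface U (\<lambda>p. E (y p) + r p *\<^sub>R e)"
  proof (rule generalized_framed_base_surfaceI[OF U])
    show "smooth_on U (\<lambda>p. E (y p) + r p *\<^sub>R e)" by (intro intros sr)
    show "smooth_on U (\<lambda>p. lift (r p) (y p) (lp p))" "smooth_on U (\<lambda>p. lift (r p) (y p) (lm p))"
      by (intro slift sm)+
    show "smooth_on U (\<lambda>p. \<sigma> * \<alpha> p)" "smooth_on U (\<lambda>p. \<sigma> * \<beta> p)"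
      by (intro intros)+
    fix p assume p: "p \<in> U"
    show "E (y p) + r p *\<^sub>R e \<in> hyperbolic_3_space"
      using y1[OF p] r(2)[OF p]
      by (simp only: hyperbolic_3_space_def mem_Collect_eq timelike inner) (simp add: power2_eq_square)
    show "lorentz_inner (E (y p) + r p *\<^sub>R e) (lift (r p) (y p) (lp p)) = 0"
      "lorentz_inner (E (y p) + r p *\<^sub>R e) (lift (r p) (y p) (lm p)) = 0"
      using lift_orthogonal[OF r[OF p]] by blast+
    define P where "P = lorentz_inner (y p) (lp p)"
    define Q where "Q = lorentz_inner (y p) (lm p)"
    have PQ: "P * Q > 1"
      unfolding P_def Q_def by (rule lightlike_pair_products[OF yy[OF p] light[OF p]])
    then have "P \<noteq> 0" by auto
    have gram: "lorentz_inner (lift (r p) (y p) (lp p)) (lift (r p) (y p) (lp p)) = P * P / (r p)\<^sup>2"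
      "lorentz_inner (lift (r p) (y p) (lp p)) (lift (r p) (y p) (lm p)) = (P * Q - 2) / (r p)\<^sup>2"
      "lorentz_inner (lift (r p) (y p) (lm p)) (lift (r p) (y p) (lm p)) = Q * Q / (r p)\<^sup>2"
      using lift_inner[OF r[OF p]] light[OF p] by (simp_all add: P_def Q_def)
    show "lorentz_inner (lift (r p) (y p) (lp p)) (lift (r p) (y p) (lp p)) > 0"
      unfolding gram using \<open>P \<noteq> 0\<close> r(1)[OF p]
      by (metis divide_pos_pos not_square_less_zero not_less_iff_gr_or_eq mult_eq_0_iff zero_less_power2)
    \<comment> \<open>The difference of the two sides is \<open>4 (P Q - 1)\<close>.\<close>
    have "(P * Q - 2)\<^sup>2 < (P * P) * (Q * Q)"
      using PQ by (simp add: power2_eq_square algebra_simps)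
    then have "(P * Q - 2)\<^sup>2 / ((r p)\<^sup>2)\<^sup>2 < (P * P) * (Q * Q) / ((r p)\<^sup>2)\<^sup>2"
      using r(1)[OF p] by (intro divide_strict_right_mono) auto
    then show "(lorentz_inner (lift (r p) (y p) (lp p)) (lift (r p) (y p) (lm p)))\<^sup>2
        < lorentz_inner (lift (r p) (y p) (lp p)) (lift (r p) (y p) (lp p))
          * lorentz_inner (lift (r p) (y p) (lm p)) (lift (r p) (y p) (lm p))"
      unfolding gram by (simp add: power_divide power2_eq_square[of "(r p)\<^sup>2"])
    show "lorentz_wedge3 (E (y p) + r p *\<^sub>R e) (partial_u (\<lambda>p. E (y p) + r p *\<^sub>R e) p)
         (partial_v (\<lambda>p. E (y p) + r p *\<^sub>R e) p)
       = (\<sigma> * \<alpha> p) *\<^sub>R lift (r p) (y p) (lp p) + (\<sigma> * \<beta> p) *\<^sub>R lift (r p) (y p) (lm p)"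
      unfolding partials[OF p] wedge[OF p] lift_linear by (simp add: algebra_simps)
  qed
  then show ?thesis by (simp add: r_def)
qed

end

section \<open>The three coordinate splittings\<close>

lemma axis_4:
  "axis (2::4) (1::real) $ 1 = 0" "axis (2::4) (1::real) $ 2 = 1"
  "axis (2::4) (1::real) $ 3 = 0" "axis (2::4) (1::real) $ 4 = 0"
  "axis (3::4) (1::real) $ 1 = 0" "axis (3::4) (1::real) $ 2 = 0"
  "axis (3::4) (1::real) $ 3 = 1" "axis (3::4) (1::real) $ 4 = 0"
  "axis (4::4) (1::real) $ 1 = 0" "axis (4::4) (1::real) $ 2 = 0"
  "axis (4::4) (1::real) $ 3 = 0" "axis (4::4) (1::real) $ 4 = 1"
  by (simp_all add: axis_def)

lemmas coordinates =
  vector_4 vector_3 axis_4 lorentz_inner_3 lorentz_inner_4 det_3 det_4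

lemma minkowski_splitting_2:
  "minkowski_splitting (\<lambda>y. vector [y$1, 0, y$2, y$3]) (axis 2 1) (-1)"
proof (rule minkowski_splitting.intro)
  show "linear (\<lambda>y::real^3. vector [y$1, 0, y$2, y$3] :: real^4)"
    by (rule linearI) (simp_all add: vec_eq_iff forall_4 coordinates)
  show "\<exists>(y::real^3) t. w = vector [y$1, 0, y$2, y$3] + t *\<^sub>R axis 2 1" for w :: "real^4"
    by (rule exI[of _ "vector [w$1, w$3, w$4]"], rule exI[of _ "w$2"])
      (simp add: vec_eq_iff forall_4 coordinates)
qed (simp_all add: vec_eq_iff forall_4 coordinates algebra_simps)

lemma minkowski_splitting_3:
  "minkowski_splitting (\<lambda>y. vector [y$1, y$2, 0, y$3]) (axis 3 1) 1"
proof (rule minkowski_splitting.intro)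
  show "linear (\<lambda>y::real^3. vector [y$1, y$2, 0, y$3] :: real^4)"
    by (rule linearI) (simp_all add: vec_eq_iff forall_4 coordinates)
  show "\<exists>(y::real^3) t. w = vector [y$1, y$2, 0, y$3] + t *\<^sub>R axis 3 1" for w :: "real^4"
    by (rule exI[of _ "vector [w$1, w$2, w$4]"], rule exI[of _ "w$3"])
      (simp add: vec_eq_iff forall_4 coordinates)
qed (simp_all add: vec_eq_iff forall_4 coordinates algebra_simps)

lemma minkowski_splitting_4:
  "minkowski_splitting (\<lambda>y. vector [y$1, y$2, y$3, 0]) (axis 4 1) (-1)"
proof (rule minkowski_splitting.intro)
  show "linear (\<lambda>y::real^3. vector [y$1, y$2, y$3, 0] :: real^4)"
    by (rule linearI) (simp_all add: vec_eq_iff forall_4 coordinates)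
  show "\<exists>(y::real^3) t. w = vector [y$1, y$2, y$3, 0] + t *\<^sub>R axis 4 1" for w :: "real^4"
    by (rule exI[of _ "vector [w$1, w$2, w$3]"], rule exI[of _ "w$4"])
      (simp add: vec_eq_iff forall_4 coordinates)
qed (simp_all add: vec_eq_iff forall_4 coordinates algebra_simps)

lemma graph_height_eq: "graph_height y = sqrt (- 1 - lorentz_inner y y)"
  by (simp add: graph_height_def lorentz_inner_3 power2_eq_square)

lemma p_eq_splitting:
  "p2 y = vector [y$1, 0, y$2, y$3] + graph_height y *\<^sub>R axis 2 1"
  "p3 y = vector [y$1, y$2, 0, y$3] + graph_height y *\<^sub>R axis 3 1"
  "p4 y = vector [y$1, y$2, y$3, 0] + graph_height y *\<^sub>R axis 4 1"
  by (simp_all add: vec_eq_iff forall_4 p2_def p3_def p4_def coordinates)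

theorem proposition4p4:
  fixes U :: "(real \<times> real) set"
    and xt lp lm :: "real \<times> real \<Rightarrow> real ^ 3"
  assumes "open U" and "simply_connected U"
    and "lightcone_framed_surface U xt lp lm"
    and "\<And>p. p \<in> U \<Longrightarrow> xt p $ 1 > 0"
    and "\<And>p. p \<in> U \<Longrightarrow> (xt p $ 1)\<^sup>2 - (xt p $ 2)\<^sup>2 - (xt p $ 3)\<^sup>2 > 1"
  shows "\<forall>P \<in> {p2, p3, p4}. hyperbolic_generalized_framed_base_surface U (P \<circ> xt)"
proof -
  have "lorentz_inner (xt p) (xt p) < -1" if "p \<in> U" for p
    using assms(5)[OF that] by (simp add: lorentz_inner_3 power2_eq_square)
  note graph = minkowski_splitting.graph_is_base_surface[OF _ assms(1,3,4) this]
  show ?thesis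
    using graph[OF minkowski_splitting_2] graph[OF minkowski_splitting_3]
      graph[OF minkowski_splitting_4]
    by (simp add: o_def p_eq_splitting graph_height_eq)
qed

end
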